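(* For every connected complete multipartite graph $H$ (with at least three nodes, of constant size), there is a deterministic one-round algorithm with bandwidth $O(1)$ for $\textsc{MemDetect}(H)$ under node deletions.
   Context: A graph is complete multipartite if its node set can be partitioned into independent sets such that two nodes are adjacent iff they lie in different parts. Dynamic network model: a sequence of graphs $G^0, G^1, \ldots$ with $n$ nodes initially, each obtained from the previous by at most one node deletion; nodes have distinct IDs, know their neighbors' IDs and initially the whole of $G^0$; communication is synchronous, each round the change happens first, then each node sends a $B$-bit message to each neighbor; nodes detect changes only via their neighbor lists. A one-round algorithm must output correctly for the current graph at the end of each round. $\textsc{MemDetect}(H)$: each node $v$ outputs whether $v$ belongs to some subgraph of the current graph isomorphic to $H$. *)

theory Defs
  imports "Graph_Theory.Digraph_Isomorphism" "HOL-Library.Disjoint_Sets"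
begin

text \<open>
  A finite simple graph is a \<open>pair_graph\<close>: a finite, loop-free and symmetric
  \<open>pair_pre_digraph\<close>, each undirected edge being represented by its two arcs.
\<close>

definition complete_multipartite :: "'a pair_pre_digraph \<Rightarrow> bool" where
  "complete_multipartite H \<longleftrightarrow>
     (\<exists>P. partition_on (pverts H) P \<and>
          (\<forall>X\<in>P. \<forall>Y\<in>P. \<forall>u\<in>X. \<forall>v\<in>Y. (u, v) \<in> parcs H \<longleftrightarrow> X \<noteq> Y))"

text \<open>
  Subgraphs need not be induced. A subgraph isomorphic to a simple graph \<open>H\<close> is itself a
  simple graph, so \<open>K\<close> need not be restricted further.
\<close>

definition mem_detect :: "'h pair_pre_digraph \<Rightarrow> 'v pair_pre_digraph \<Rightarrow> 'v \<Rightarrow> bool" where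
  "mem_detect H G v \<longleftrightarrow>
     (\<exists>K. subgraph (with_proj K) (with_proj G) \<and> digraph_iso (with_proj K) (with_proj H)
          \<and> v \<in> pverts K)"


subsection \<open>Dynamic networks under node deletions\<close>

text \<open>Nodes are identified with their IDs, which are natural numbers.\<close>

type_synonym network = "nat pair_pre_digraph"

definition neighbors :: "network \<Rightarrow> nat \<Rightarrow> nat set" where
  "neighbors G v = {u. (v, u) \<in> parcs G}"

definition node_deletion_sequence :: "(nat \<Rightarrow> network) \<Rightarrow> bool" where
  "node_deletion_sequence G \<longleftrightarrow>
     pair_graph (G 0) \<and>
     (\<forall>t. G (Suc t) = G t \<or>
          (\<exists>u \<in> pverts (G t).
             with_proj (G (Suc t)) = pre_digraph.del_vert (with_proj (G t)) u))"


subsection \<open>Deterministic distributed algorithms\<close>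

text \<open>
  A node state is taken to be everything the node has observed so far: its ID, the initial
  graph, and for each past round, in chronological order, its neighborhood in that round and
  the messages received, indexed by sender. Any other choice of local state is a function of
  this one, so an arbitrary deterministic algorithm is given by how messages and outputs depend
  on it.
\<close>

type_synonym bits = "bool list"

record node_view =
  own_id :: nat
  initial_graph :: network
  observations :: "(nat set \<times> (nat \<rightharpoonup> bits)) list"

text \<open>
  \<open>message A s N u\<close> is the message that a node in state \<open>s\<close> whose current neighborhood is \<open>N\<close>
  sends to its neighbor \<open>u\<close>; it may differ from neighbor to neighbor.
\<close>

record algorithm =
  message :: "node_view \<Rightarrow> nat set \<Rightarrow> nat \<Rightarrow> bits"
  answer :: "node_view \<Rightarrow> bool"

definition has_bandwidth :: "algorithm \<Rightarrow> nat \<Rightarrow> bool" where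
  "has_bandwidth A B \<longleftrightarrow> (\<forall>s N u. length (message A s N u) = B)"

text \<open>
  \<open>view_after A G t v\<close> is the state of \<open>v\<close> at the end of round \<open>t\<close>; time \<open>0\<close> precedes the first
  round. In round \<open>t + 1\<close> the graph first becomes \<open>G (t + 1)\<close>, then every node, having seen its
  new neighborhood but no message of this round, sends along the edges of \<open>G (t + 1)\<close>. The value
  is meaningful only for nodes of \<open>G t\<close>; deleted nodes have no neighbors and influence no one.
\<close>

primrec view_after :: "algorithm \<Rightarrow> (nat \<Rightarrow> network) \<Rightarrow> nat \<Rightarrow> nat \<Rightarrow> node_view" where
  "view_after A G 0 v = \<lparr>own_id = v, initial_graph = G 0, observations = []\<rparr>"
| "view_after A G (Suc t) v =
     (let nbrs = neighbors (G (Suc t));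
          inbox = (\<lambda>u. if u \<in> nbrs v
                       then Some (message A (view_after A G t u) (nbrs u) v) else None)
      in (view_after A G t v)
           \<lparr>observations := observations (view_after A G t v) @ [(nbrs v, inbox)]\<rparr>)"

definition one_round_solves_under_node_deletions ::
    "algorithm \<Rightarrow> (network \<Rightarrow> nat \<Rightarrow> bool) \<Rightarrow> bool" where
  "one_round_solves_under_node_deletions A P \<longleftrightarrow>
     (\<forall>G. node_deletion_sequence G \<longrightarrow>
        (\<forall>t\<ge>1. \<forall>v \<in> pverts (G t). answer A (view_after A G t v) \<longleftrightarrow> P (G t) v))"

end

theory Submission
  imports Defs
begin

text \<open>
  In every round each node tells its neighbors, by one bit, whether its own neighborhood has
  changed. If \<open>v\<close> plays a vertex of the part \<open>X\<close> of \<open>H\<close>, the other parts of \<open>H\<close> are embedded into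
  a nonempty set \<open>U\<close> of neighbors of \<open>v\<close>, and all that is required of the remaining vertices of
  \<open>X\<close> is that they are common neighbors of \<open>U\<close>. So \<open>v\<close> only needs the number of common neighbors
  of \<open>U\<close>. A deleted node was a common neighbor of \<open>U\<close> iff all nodes of \<open>U\<close> report a change in that
  round, hence \<open>v\<close> can maintain this number although it cannot tell which node was deleted.
\<close>

section \<open>Copies of \<open>H\<close> as embeddings, and membership as a count of common
  neighbors\<close>

text \<open>A digraph isomorphism maps vertices and arcs separately, but in a pair graph an arc is
  the pair of its ends, so the vertex map alone carries all the information.\<close>

lemma mem_detect_iff_embedding:
  fixes H :: "'h pair_pre_digraph" and G :: "'v pair_pre_digraph"
  assumes H: "pair_wf_digraph H" and G: "pair_wf_digraph G"
  shows "mem_detect H G v \<longleftrightarrow>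
    (\<exists>g. inj_on g (pverts H) \<and> g ` pverts H \<subseteq> pverts G \<and> map_prod g g ` parcs H \<subseteq> parcs G \<and>
         v \<in> g ` pverts H)"
proof
  assume "mem_detect H G v"
  then obtain K where K: "subgraph (with_proj K) (with_proj G)"
      "digraph_iso (with_proj K) (with_proj H)" "v \<in> pverts K"
    by (auto simp: mem_detect_def)
  have "wf_digraph (with_proj K)"
    using K(1) by (simp add: subgraph_def)
  then have "digraph_iso (with_proj H) (with_proj K)"
    using K(2) by (rule digraph_iso_swap)
  then obtain hom where hom: "pre_digraph.digraph_isomorphism (with_proj H) hom"
      and K_eq: "with_proj K = app_iso hom (with_proj H)"
    by (auto simp: digraph_iso_def)
  have "pverts K = iso_verts hom ` pverts H" "parcs K = iso_arcs hom ` parcs H"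
      "iso_tail hom = fst" "iso_head hom = snd"
    using arg_cong[OF K_eq, of verts] arg_cong[OF K_eq, of arcs]
      arg_cong[OF K_eq, of tail] arg_cong[OF K_eq, of head] by auto
  \<comment> \<open>Compatibility of \<open>hom\<close> with tails and heads, which are
    \<open>fst\<close> and \<open>snd\<close> on both sides, leaves no choice for the arc
    map.\<close>
  moreover from this have "iso_arcs hom a = map_prod (iso_verts hom) (iso_verts hom) a"
    if "a \<in> parcs H" for a
    using hom that by (cases a) (auto simp: pre_digraph.digraph_isomorphism_def prod_eq_iff)
  ultimately show "\<exists>g. inj_on g (pverts H) \<and> g ` pverts H \<subseteq> pverts G \<and>
      map_prod g g ` parcs H \<subseteq> parcs G \<and> v \<in> g ` pverts H"
    using hom K by (intro exI[of _ "iso_verts hom"])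
      (auto simp: pre_digraph.digraph_isomorphism_def subgraph_def image_subset_iff)
next
  assume "\<exists>g. inj_on g (pverts H) \<and> g ` pverts H \<subseteq> pverts G \<and>
      map_prod g g ` parcs H \<subseteq> parcs G \<and> v \<in> g ` pverts H"
  then obtain g where g: "inj_on g (pverts H)" "g ` pverts H \<subseteq> pverts G"
      "map_prod g g ` parcs H \<subseteq> parcs G" "v \<in> g ` pverts H"
    by blast
  define K where "K = \<lparr>pverts = g ` pverts H, parcs = map_prod g g ` parcs H\<rparr>"
  define hom where "hom = \<lparr>iso_verts = g, iso_arcs = map_prod g g, iso_head = snd, iso_tail = fst\<rparr>"
  have arcs_H: "parcs H \<subseteq> pverts H \<times> pverts H"
    using H pair_wf_digraph.wellformed' by fastforce
  then have inj: "inj_on (map_prod g g) (parcs H)"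
    using map_prod_inj_on[OF g(1) g(1)] by (rule inj_on_subset[rotated])
  have wf_K: "wf_digraph (with_proj K)"
    using arcs_H by (auto simp: wf_digraph_def K_def)
  have "pre_digraph.digraph_isomorphism (with_proj H) hom"
    using H g(1) inj by (auto simp: pre_digraph.digraph_isomorphism_def hom_def wf_digraph_wp_iff)
  moreover have "with_proj K = app_iso hom (with_proj H)"
    by (simp add: with_proj_def app_iso_def K_def hom_def)
  ultimately have "digraph_iso (with_proj H) (with_proj K)"
    by (auto simp: digraph_iso_def)
  moreover have "wf_digraph (with_proj H)"
    using H by (simp add: wf_digraph_wp_iff)
  ultimately have "digraph_iso (with_proj K) (with_proj H)"
    by (rule digraph_iso_swap[rotated])
  moreover have "subgraph (with_proj K) (with_proj G)"
    using g G wf_K by (simp add: subgraph_def K_def compatibleI_with_proj wf_digraph_wp_iff)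
  ultimately show "mem_detect H G v"
    using g(4) unfolding mem_detect_def by (intro exI[of _ K]) (simp add: K_def)
qed

definition common_neighbors :: "network \<Rightarrow> nat set \<Rightarrow> nat set" where
  "common_neighbors G U = {w \<in> pverts G. U \<subseteq> neighbors G w}"

text \<open>Nothing is asked of \<open>f\<close> on \<open>X\<close>: the images of these vertices
  are never named, only counted.\<close>

definition embeds_outside :: "('h \<Rightarrow> nat) \<Rightarrow> 'h pair_pre_digraph \<Rightarrow> 'h set \<Rightarrow> nat rel \<Rightarrow> bool" where
  "embeds_outside f H X E \<longleftrightarrow> inj_on f (pverts H - X) \<and>
     (\<forall>a\<in>pverts H - X. \<forall>b\<in>pverts H - X. (a, b) \<in> parcs H \<longrightarrow> (f a, f b) \<in> E)"

text \<open>\<open>X\<close> is the part of the vertex played by \<open>v\<close>. As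
  \<open>X\<close> is independent, its images need only be adjacent to all images from outside
  \<open>X\<close>; any \<open>card X\<close> common neighbors, \<open>v\<close> among them, will
  do.\<close>

lemma mem_detect_iff_common_neighbors:
  fixes H :: "'h pair_pre_digraph" and G :: network
  assumes H: "pair_graph H" and G: "pair_graph G" and v: "v \<in> pverts G"
    and P: "partition_on (pverts H) P"
    and multipartite: "\<forall>X\<in>P. \<forall>Y\<in>P. \<forall>a\<in>X. \<forall>b\<in>Y. (a, b) \<in> parcs H \<longleftrightarrow> X \<noteq> Y"
  shows "mem_detect H G v \<longleftrightarrow>
    (\<exists>X\<in>P. \<exists>f. embeds_outside f H X (parcs G) \<and> f ` (pverts H - X) \<subseteq> neighbors G v \<and>
       card X \<le> card (common_neighbors G (f ` (pverts H - X))))"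
proof -
  interpret H: pair_graph H by (rule H)
  interpret G: pair_graph G by (rule G)
  have sym_G: "(a, b) \<in> parcs G \<Longrightarrow> (b, a) \<in> parcs G" for a b
    using G.graph_symmetric by simp
  have part: "X \<subseteq> pverts H" if "X \<in> P" for X
    using P that by (auto simp: partition_on_def)
  have cross: "(a, b) \<in> parcs H" if "X \<in> P" "a \<in> X" "b \<in> pverts H - X" for X a b
    using that multipartite P unfolding partition_on_def by blast
  have fin_common: "finite (common_neighbors G U)" for U
    by (simp add: common_neighbors_def)
  have wf: "pair_wf_digraph H" "pair_wf_digraph G"
    by (rule H.pair_wf_digraph_axioms G.pair_wf_digraph_axioms)+
  show ?thesis
    unfolding mem_detect_iff_embedding[OF wf]
  proof
    assume "\<exists>g. inj_on g (pverts H) \<and> g ` pverts H \<subseteq> pverts G \<and>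
      map_prod g g ` parcs H \<subseteq> parcs G \<and> v \<in> g ` pverts H"
    then obtain g h where g: "inj_on g (pverts H)" "g ` pverts H \<subseteq> pverts G"
        "map_prod g g ` parcs H \<subseteq> parcs G" and h: "h \<in> pverts H" "v = g h"
      by blast
    then obtain X where X: "X \<in> P" "h \<in> X"
      using P unfolding partition_on_def by blast
    have adj: "(g a, g b) \<in> parcs G" if "(a, b) \<in> parcs H" for a b
      using g(3) that by force
    have "g ` X \<subseteq> common_neighbors G (g ` (pverts H - X))"
      using X part[OF X(1)] g(2) cross[OF X(1)] adj
      by (auto simp: common_neighbors_def neighbors_def)
    then have "card (g ` X) \<le> card (common_neighbors G (g ` (pverts H - X)))"
      by (rule card_mono[OF fin_common])
    moreover have "card (g ` X) = card X"
      using g(1) part[OF X(1)] by (intro card_image) (rule inj_on_subset)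
    ultimately show "\<exists>X\<in>P. \<exists>f. embeds_outside f H X (parcs G) \<and>
        f ` (pverts H - X) \<subseteq> neighbors G v \<and>
        card X \<le> card (common_neighbors G (f ` (pverts H - X)))"
      using X h g(1) adj cross[OF X(1) X(2)]
      by (intro bexI[OF _ X(1)] exI[of _ g])
         (auto simp: embeds_outside_def neighbors_def intro: inj_on_subset)
  next
    assume "\<exists>X\<in>P. \<exists>f. embeds_outside f H X (parcs G) \<and>
      f ` (pverts H - X) \<subseteq> neighbors G v \<and>
      card X \<le> card (common_neighbors G (f ` (pverts H - X)))"
    then obtain X f where X: "X \<in> P" and f: "embeds_outside f H X (parcs G)"
        "f ` (pverts H - X) \<subseteq> neighbors G v"
        "card X \<le> card (common_neighbors G (f ` (pverts H - X)))"
      by blast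
    let ?C = "common_neighbors G (f ` (pverts H - X))"
    have fin_X: "finite X"
      using part[OF X] H.pair_finite_verts by (rule finite_subset)
    obtain h where h: "h \<in> X"
      using X partition_onD3[OF P] by fastforce
    have "v \<in> ?C"
      using v f(2) by (auto simp: common_neighbors_def)
    \<comment> \<open>The vertex \<open>h\<close> is played by \<open>v\<close>, itself a common
      neighbor; the rest of \<open>X\<close> needs \<open>card X - 1\<close> others.\<close>
    moreover have "card X - 1 \<le> card (?C - {v})"
      using f(3) \<open>v \<in> ?C\<close> fin_common by simp
    then obtain W where W: "W \<subseteq> ?C - {v}" "card W = card X - 1"
      by (meson obtain_subset_with_card_n)
    moreover have "finite W"
      using W(1) fin_common by (meson finite_Diff finite_subset)
    moreover have "card (X - {h}) = card X - 1"
      using h by simp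
    ultimately obtain b where b: "bij_betw b (X - {h}) W"
      using fin_X finite_same_card_bij[of "X - {h}" W] by auto
    define g where "g a = (if a = h then v else if a \<in> X then b a else f a)" for a
    have bij: "bij_betw g X (insert v W)"
    proof -
      have "bij_betw g (X - {h}) W"
        using b by (rule bij_betw_cong[THEN iffD1, rotated]) (auto simp: g_def)
      moreover have "g h = v"
        by (simp add: g_def)
      ultimately show ?thesis
        using notIn_Un_bij_betw[of h "X - {h}" g W] W(1) h by (auto simp: insert_absorb)
    qed
    have g_f: "g a = f a" if "a \<notin> X" for a
      using that h by (auto simp: g_def)
    have g_X: "g ` X \<subseteq> ?C"
      using bij W(1) \<open>v \<in> ?C\<close> by (auto simp: bij_betw_def)
    have adj: "(g a, g b) \<in> parcs G" if "a \<in> X" "b \<in> pverts H - X" for a b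
      using g_X that by (auto simp: common_neighbors_def neighbors_def g_f)
    have inj: "inj_on g (pverts H)"
    proof (rule inj_onI)
      fix x y assume xy: "x \<in> pverts H" "y \<in> pverts H" "g x = g y"
      \<comment> \<open>If an image of \<open>X\<close> equalled an image from outside, the arc
        given by \<open>adj\<close> would be a loop.\<close>
      have "g a \<noteq> g b" if "a \<in> X" "b \<in> pverts H - X" for a b
        using G.pair_no_loops[OF adj[OF that]] by simp
      then show "x = y"
        using xy bij f(1)
        by (cases "x \<in> X"; cases "y \<in> X")
           (auto simp: bij_betw_def embeds_outside_def g_f dest: inj_onD, metis)
    qed
    have arcs: "(g x, g y) \<in> parcs G" if "(x, y) \<in> parcs H" for x y
    proof -
      have "x \<in> pverts H" "y \<in> pverts H"
        using that H.wellformed' by auto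
      moreover have "\<not> (x \<in> X \<and> y \<in> X)"
        using that multipartite X by auto
      ultimately show ?thesis
        using adj sym_G f(1) that
        by (cases "x \<in> X"; cases "y \<in> X") (auto simp: embeds_outside_def g_f)
    qed
    have "g ` pverts H \<subseteq> pverts G"
    proof
      fix y assume "y \<in> g ` pverts H"
      then obtain x where x: "x \<in> pverts H" "y = g x" by auto
      show "y \<in> pverts G"
      proof (cases "x \<in> X")
        case True
        then show ?thesis using g_X x by (auto simp: common_neighbors_def)
      next
        case False
        then show ?thesis using adj[OF h, of x] x G.wellformed' by auto
      qed
    qed
    moreover have "v \<in> g ` pverts H"
      using h part[OF X] by (intro image_eqI[of _ _ h]) (auto simp: g_def)
    ultimately show "\<exists>g. inj_on g (pverts H) \<and> g ` pverts H \<subseteq> pverts G \<and>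
        map_prod g g ` parcs H \<subseteq> parcs G \<and> v \<in> g ` pverts H"
      using inj arcs by (intro exI[of _ g]) auto
  qed
qed

text \<open>An independent set covering \<open>H\<close> leaves no arcs to connect two distinct
  vertices. This keeps \<open>U\<close> nonempty; for empty \<open>U\<close> every node would count
  as a common neighbor, even those whose deletion \<open>v\<close> cannot notice.\<close>

lemma connected_imp_no_full_part:
  assumes conn: "Digraph_Component.connected (with_proj H)" and card: "card (pverts H) \<ge> 2"
    and X: "pverts H \<subseteq> X" and indep: "\<forall>a\<in>X. \<forall>b\<in>X. (a, b) \<notin> parcs H"
    and H: "pair_wf_digraph H"
  shows False
proof -
  have "finite (pverts H)"
    using card by (intro card_ge_0_finite) simp
  then obtain a b where ab: "a \<in> pverts H" "b \<in> pverts H" "a \<noteq> b"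
    using card card_le_Suc0_iff_eq[of "pverts H"] by auto
  have "parcs H = {}"
    using X indep H pair_wf_digraph.wellformed' by fastforce
  then have "parcs (mk_symmetric (with_proj H)) = {}"
    by (simp add: parcs_mk_symmetric)
  moreover have "a \<rightarrow>\<^sup>*\<^bsub>with_proj (mk_symmetric (with_proj H))\<^esub> b"
    using conn ab by (simp add: connected_def strongly_connected_def)
  ultimately show False
    using ab(3) by (auto simp: reachable_def elim: rtrancl_on.cases)
qed

subsection \<open>Counting common neighbors under deletions\<close>

lemma node_deletion_step:
  assumes "node_deletion_sequence G"
  obtains "G (Suc t) = G t"
  | d where "d \<in> pverts (G t)" "pverts (G (Suc t)) = pverts (G t) - {d}"
      "parcs (G (Suc t)) = {a \<in> parcs (G t). fst a \<noteq> d \<and> snd a \<noteq> d}"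
proof -
  from assms consider "G (Suc t) = G t"
    | d where "d \<in> pverts (G t)"
      "with_proj (G (Suc t)) = pre_digraph.del_vert (with_proj (G t)) d"
    unfolding node_deletion_sequence_def by blast
  then show thesis
  proof cases
    case 1
    then show thesis by (rule that(1))
  next
    case (2 d)
    show thesis
      using that(2)[OF 2(1)] arg_cong[OF 2(2), of verts] arg_cong[OF 2(2), of arcs]
      by (simp add: pre_digraph.del_vert_def)
  qed
qed

lemma pair_graph_node_deletion:
  assumes G: "node_deletion_sequence G"
  shows "pair_graph (G t)"
proof (induction t)
  case 0
  show ?case using G by (simp add: node_deletion_sequence_def)
next
  case (Suc t)
  interpret pair_graph "G t" by (rule Suc)
  have sym: "(a, b) \<in> parcs (G t) \<Longrightarrow> (b, a) \<in> parcs (G t)" for a b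
    using graph_symmetric by simp
  show ?case
  proof (cases rule: node_deletion_step[OF G, of t])
    case 1
    then show ?thesis using Suc by simp
  next
    case (2 d)
    then show ?thesis
      using pair_finite_verts pair_finite_arcs wellformed' sym
      by unfold_locales
         (auto simp: symmetric_def arcs_ends_conv intro!: symI dest: pair_no_loops)
  qed
qed

text \<open>Each graph is induced in \<open>G 0\<close>, so adjacency between surviving nodes can be
  read off the initial graph.\<close>

lemma parcs_node_deletion:
  assumes G: "node_deletion_sequence G"
  shows "parcs (G t) = parcs (G 0) \<inter> pverts (G t) \<times> pverts (G t)"
proof (induction t)
  case 0
  show ?case
    using pair_graph_node_deletion[OF G, of 0] by (auto simp: pair_graph_def pair_digraph_def
        pair_fin_digraph_def dest: pair_wf_digraph.wellformed')
next
  case (Suc t)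
  show ?case
    by (cases rule: node_deletion_step[OF G, of t]) (use Suc in auto)
qed

lemma neighbors_Suc_subset:
  assumes "node_deletion_sequence G"
  shows "neighbors (G (Suc t)) v \<subseteq> neighbors (G t) v"
  by (cases rule: node_deletion_step[OF assms, of t]) (auto simp: neighbors_def)

text \<open>For a surviving \<open>u\<close>, a changed neighborhood means adjacency to the one
  deleted node. Nonemptiness of \<open>U\<close> keeps the condition from holding vacuously in a
  round without deletion.\<close>

lemma card_common_neighbors_Suc:
  assumes G: "node_deletion_sequence G" and U: "U \<noteq> {}" "U \<subseteq> pverts (G (Suc t))"
  shows "card (common_neighbors (G t) U) = card (common_neighbors (G (Suc t)) U) +
    (if \<forall>u\<in>U. neighbors (G (Suc t)) u \<noteq> neighbors (G t) u then 1 else 0)"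
proof (cases rule: node_deletion_step[OF G, of t])
  case 1
  then show ?thesis using U by auto
next
  case (2 d)
  interpret pair_graph "G t" by (rule pair_graph_node_deletion[OF G])
  have sym: "(a, b) \<in> parcs (G t) \<longleftrightarrow> (b, a) \<in> parcs (G t)" for a b
    using graph_symmetric by auto
  have "neighbors (G (Suc t)) u \<noteq> neighbors (G t) u \<longleftrightarrow> u \<in> neighbors (G t) d" if "u \<in> U" for u
    using that U(2) 2 sym[of u d] by (auto simp: neighbors_def)
  then have changed: "(\<forall>u\<in>U. neighbors (G (Suc t)) u \<noteq> neighbors (G t) u) \<longleftrightarrow>
      d \<in> common_neighbors (G t) U"
    using 2(1) by (auto simp: common_neighbors_def)
  have remove: "common_neighbors (G (Suc t)) U = common_neighbors (G t) U - {d}"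
    using 2 U(2) by (auto simp: common_neighbors_def neighbors_def)
  have "finite (common_neighbors (G t) U)"
    by (simp add: common_neighbors_def)
  then show ?thesis
    unfolding changed remove using card.remove[of "common_neighbors (G t) U" d]
    by (cases "d \<in> common_neighbors (G t) U") simp_all
qed

subsection \<open>The algorithm\<close>

text \<open>Falling back on the initial graph makes a deletion in the first round
  detectable.\<close>

definition latest_neighbors :: "node_view \<Rightarrow> nat set" where
  "latest_neighbors s = (if observations s = [] then neighbors (initial_graph s) (own_id s)
     else fst (last (observations s)))"

definition lost_common_neighbors :: "node_view \<Rightarrow> nat set \<Rightarrow> nat" where
  "lost_common_neighbors s U =
     length (filter (\<lambda>(N, inbox). \<forall>u\<in>U. inbox u = Some [True]) (observations s))"

text \<open>The state passed to \<open>message\<close> lacks the current round, so \<open>N\<close>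
  is compared with the preceding neighborhood, whereas in \<open>answer\<close> the same function
  yields the current one. Adding the losses to \<open>card X\<close> avoids truncated
  subtraction.\<close>

definition membership_algorithm :: "'h pair_pre_digraph \<Rightarrow> 'h set set \<Rightarrow> algorithm" where
  "membership_algorithm H P = \<lparr>
     message = (\<lambda>s N u. [N \<noteq> latest_neighbors s]),
     answer = (\<lambda>s. \<exists>X\<in>P. \<exists>f. embeds_outside f H X (parcs (initial_graph s)) \<and>
       f ` (pverts H - X) \<subseteq> latest_neighbors s \<and>
       card X + lost_common_neighbors s (f ` (pverts H - X))
         \<le> card (common_neighbors (initial_graph s) (f ` (pverts H - X))))\<rparr>"

lemma own_id_view_after [simp]: "own_id (view_after A G t v) = v"
  by (induction t) (simp_all add: Let_def)

lemma initial_graph_view_after [simp]: "initial_graph (view_after A G t v) = G 0"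
  by (induction t) (simp_all add: Let_def)

lemma latest_neighbors_view_after [simp]:
  "latest_neighbors (view_after A G t v) = neighbors (G t) v"
  by (cases t) (simp_all add: latest_neighbors_def Let_def)

text \<open>Neighborhoods only shrink, so all of \<open>U\<close> were neighbors of \<open>v\<close>
  in every earlier round and each of their reports arrived.\<close>

lemma card_common_neighbors_view_after:
  assumes G: "node_deletion_sequence G" and U: "U \<noteq> {}" "U \<subseteq> neighbors (G t) v"
  shows "card (common_neighbors (G 0) U) = card (common_neighbors (G t) U) +
    lost_common_neighbors (view_after (membership_algorithm H P) G t v) U"
  using U(2)
proof (induction t)
  case 0
  show ?case by (simp add: lost_common_neighbors_def)
next
  case (Suc t)
  interpret pair_graph "G (Suc t)" by (rule pair_graph_node_deletion[OF G])
  have "U \<subseteq> pverts (G (Suc t))"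
    using Suc.prems wellformed' by (auto simp: neighbors_def)
  note step = card_common_neighbors_Suc[OF G U(1) this]
  have "lost_common_neighbors (view_after (membership_algorithm H P) G (Suc t) v) U =
      lost_common_neighbors (view_after (membership_algorithm H P) G t v) U +
      (if \<forall>u\<in>U. neighbors (G (Suc t)) u \<noteq> neighbors (G t) u then 1 else 0)"
    using Suc.prems
    by (auto simp: lost_common_neighbors_def Let_def membership_algorithm_def subset_iff)
  moreover have "U \<subseteq> neighbors (G t) v"
    using Suc.prems neighbors_Suc_subset[OF G] by blast
  ultimately show ?case
    using Suc.IH step by simp
qed

theorem theorem6p8:
  fixes H :: "'h pair_pre_digraph"
  assumes "pair_graph H"
    and "Digraph_Component.connected (with_proj H)"
    and "complete_multipartite H"
    and "card (pverts H) \<ge> 3"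
  shows "\<exists>B A. has_bandwidth A B \<and> one_round_solves_under_node_deletions A (mem_detect H)"
proof -
  interpret H: pair_graph H by (rule assms(1))
  obtain P where P: "partition_on (pverts H) P"
    and multipartite: "\<forall>X\<in>P. \<forall>Y\<in>P. \<forall>u\<in>X. \<forall>v\<in>Y. (u, v) \<in> parcs H \<longleftrightarrow> X \<noteq> Y"
    using assms(3) unfolding complete_multipartite_def by blast
  define A where "A = membership_algorithm H P"
  have proper: "pverts H - X \<noteq> {}" if "X \<in> P" for X
    using connected_imp_no_full_part[OF assms(2), of X] assms(4) multipartite that
      H.pair_wf_digraph_axioms by auto
  have "answer A (view_after A G t v) \<longleftrightarrow> mem_detect H (G t) v"
    if G: "node_deletion_sequence G" and v: "v \<in> pverts (G t)" for G t v
  proof -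
    let ?lost = "lost_common_neighbors (view_after A G t v)"
    interpret Gt: pair_graph "G t" by (rule pair_graph_node_deletion[OF G])
    \<comment> \<open>The algorithm's test and the criterion for \<open>G t\<close> are compared for
      fixed \<open>X\<close> and \<open>f\<close>, so the same witnesses serve both
      directions.\<close>
    have "embeds_outside f H X (parcs (G 0)) \<and> f ` (pverts H - X) \<subseteq> neighbors (G t) v \<and>
        card X + ?lost (f ` (pverts H - X)) \<le> card (common_neighbors (G 0) (f ` (pverts H - X)))
      \<longleftrightarrow> embeds_outside f H X (parcs (G t)) \<and> f ` (pverts H - X) \<subseteq> neighbors (G t) v \<and>
        card X \<le> card (common_neighbors (G t) (f ` (pverts H - X)))" (is "?L \<longleftrightarrow> ?R")
      if X: "X \<in> P" for X f
    \<comment> \<open>The shared neighborhood condition puts the image among surviving nodes, where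
      arcs agree with \<open>G 0\<close> and the losses are known. Without it both sides are
      false.\<close>
    proof (cases "f ` (pverts H - X) \<subseteq> neighbors (G t) v")
      case True
      then have "f ` (pverts H - X) \<subseteq> pverts (G t)"
        using Gt.wellformed' by (auto simp: neighbors_def)
      then have "embeds_outside f H X (parcs (G 0)) \<longleftrightarrow> embeds_outside f H X (parcs (G t))"
        unfolding parcs_node_deletion[OF G, of t] by (auto simp: embeds_outside_def)
      moreover have "f ` (pverts H - X) \<noteq> {}"
        using proper[OF X] by simp
      ultimately show ?thesis
        using card_common_neighbors_view_after[OF G _ True, of H P] by (simp add: A_def)
    qed auto
    then show ?thesis
      unfolding mem_detect_iff_common_neighbors[OF assms(1) Gt.pair_graph_axioms v P multipartite]
      by (simp add: A_def membership_algorithm_def cong: bex_cong)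
  qed
  then have "one_round_solves_under_node_deletions A (mem_detect H)"
    by (simp add: one_round_solves_under_node_deletions_def)
  \<comment> \<open>One bit suffices for every \<open>H\<close>; \<open>A\<close> is fixed before
    the network, so the bound is independent of its size.\<close>
  moreover have "has_bandwidth A 1"
    by (simp add: has_bandwidth_def A_def membership_algorithm_def)
  ultimately show ?thesis by blast
qed

end
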